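(* Let $a,b,c,m,x$ be integers with $0\le c\le a+b$, $0\le m\le\min\{a,b,c,a+b-c\}$ and $\max\{c-b,0\}\le x\le\min\{a,c\}$. The Hahn polynomials satisfy the following symmetry relations: $$E_m(a,b,c,x)=(-1)^mE_m(b,a,c,c-x),$$ $$E_m(a,b,c,x)=(-1)^{a-x}\frac{m!\,(c-x)!\,(b-c+x)!}{(a+b-c-m)!\,(c-m)!\,(a-m)!}\,E_{a-m}(a,\,a+b-2m,\,a+b-m-c+x,\,x),$$ $$E_m(a,b,c,x)=E_m(a+b-c,\,c,\,b,\,b-c+x).$$
   Context: For integers with $0\le c\le a+b$, $0\le m\le\min\{a,b,c,a+b-c\}$, $\max\{c-b,0\}\le x\le\min\{a,c\}$, the Hahn polynomial is $$E_m(a,b,c,x)=\sum_{r=\max\{0,x-c+m\}}^{\min\{m,x\}}(-1)^r\binom{m}{r}(b-m+1)_r(-x)_r(a-m+1)_{m-r}(x-c)_{m-r},$$ where $(x)_s=x(x+1)\cdots(x+s-1)$. *)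

theory Defs
  imports Complex_Main
begin

text \<open>
  The parameters are integers. The intended domain is \<open>0 \<le> c \<le> a + b\<close>,
  \<open>0 \<le> m \<le> min {a, b, c, a + b - c}\<close>, \<open>max {c - b, 0} \<le> x \<le> min {a, c}\<close>. There \<open>m\<close>, \<open>r\<close> and
  \<open>m - r\<close> are nonnegative for every \<open>r\<close> in the range of summation, so \<^const>\<open>nat\<close> does not truncate.
  The rising factorial \<open>(y)_s\<close> is \<^const>\<open>pochhammer\<close>.
\<close>

definition hahn :: "int \<Rightarrow> int \<Rightarrow> int \<Rightarrow> int \<Rightarrow> int \<Rightarrow> int" where
  "hahn m a b c x =
     (\<Sum>r = max 0 (x - c + m)..min m x.
        (-1) ^ nat r * int (nat m choose nat r)
        * pochhammer (b - m + 1) (nat r) * pochhammer (- x) (nat r)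
        * pochhammer (a - m + 1) (nat (m - r)) * pochhammer (x - c) (nat (m - r)))"

end

theory Submission
  imports Defs
begin

text \<open>
  The natural coordinates are \<open>x\<close>, \<open>y = c - x\<close>, \<open>z = b - c + x\<close>, \<open>u = a - x\<close>, the entries of the
  contingency table with row sums \<open>c = x + y\<close>, \<open>a + b - c = u + z\<close> and column sums \<open>a = x + u\<close>,
  \<open>b = y + z\<close>. The defining sum of the Hahn polynomial hides its symmetry in these four numbers. Up to the
  sign \<open>(-1)\<^sup>m\<close> it equals
  \[ T = \sum_r (-1)^r \binom{m}{r} x^{(r)} z^{(r)} y^{(m-r)} u^{(m-r)}, \]
  where \<open>n\<^sup>(\<^sup>r\<^sup>)\<close> is the falling factorial (lemma \<open>hahn_eq_transvectant\<close>). To see this, expand the two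
  factors that involve \<open>b\<close> and \<open>a\<close> by the Vandermonde convolution into factorials of \<open>z\<close> and \<open>u\<close>; the
  coefficient of each resulting product is an alternating sum of trinomial coefficients, which
  vanishes off the diagonal \<open>j + k = m\<close> (lemmas \<open>alternating_trinomial_sum\<close>, \<open>transvectant_alt\<close>).

  All three symmetries are visible on \<open>T\<close>. The first one exchanges \<open>x\<close> with \<open>y\<close> and \<open>z\<close> with \<open>u\<close>, which
  amounts to reversing the summation, \<open>r \<mapsto> m - r\<close>. The third exchanges \<open>x\<close> with \<open>z\<close>, which fixes each
  summand. For the second, divide \<open>T\<close> by \<open>m! x! y! z! u!\<close>: what remains is an alternating sum of inverse
  products of the six factorials of
  \<open>r\<close>, \<open>m - r\<close>, \<open>x - r\<close>, \<open>z - r\<close>, \<open>y - m + r\<close>, \<open>u - m + r\<close>.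
  Replacing \<open>(m, x, y, z, u)\<close> by \<open>(x + u - m, x, u + z - m, x + y - m, u)\<close> and \<open>r\<close> by \<open>x - r\<close> permutes these
  six numbers (lemma \<open>transvectant_fact_sum_complement\<close>).
\<close>

section \<open>The symmetric form of the sum\<close>

text \<open>
  When \<open>X, Y, Z, U\<close> are the negatives of natural numbers \<open>x, y, z, u\<close>, this is, up to sign, the coefficient
  of the unnormalised \<open>m\<close>-th transvectant (Cayley's Omega process) of two monomials in two variables
  with exponents \<open>(x, y)\<close> and \<open>(u, z)\<close>. Rising factorials of arbitrary ring elements make the identities
  below polynomial, so that no case distinction on the size of the parameters occurs; the signs
  \<open>(X)\<^sub>r = (-1)\<^sup>r x (x - 1) \<dots> (x - r + 1)\<close> cancel because they come in pairs.
\<close>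
definition transvectant :: "nat \<Rightarrow> 'a::comm_ring_1 \<Rightarrow> 'a \<Rightarrow> 'a \<Rightarrow> 'a \<Rightarrow> 'a" where
  "transvectant m X Y Z U =
     (\<Sum>r\<le>m. (-1) ^ r * of_nat (m choose r)
        * (pochhammer X r * pochhammer Z r) * (pochhammer Y (m - r) * pochhammer U (m - r)))"

lemma transvectant_swap_XZ: "transvectant m X Y Z U = transvectant m Z Y X U"
  by (simp add: transvectant_def mult_ac)

lemma minus_one_power_diff:
  assumes "r \<le> m"
  shows "(-1) ^ (m - r) = ((-1) ^ m * (-1) ^ r :: 'a::comm_ring_1)"
proof -
  obtain k where "m = k + r" using assms by (metis le_add_diff_inverse2)
  then show ?thesis by (simp add: power_add mult.assoc)
qed

text \<open>Reversing the order of summation.\<close>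
lemma transvectant_reflect: "transvectant m Y X U Z = (-1) ^ m * transvectant m X Y Z U"
  unfolding transvectant_def sum_distrib_left
proof (rule sum.reindex_bij_witness[of _ "\<lambda>r. m - r" "\<lambda>r. m - r"], goal_cases)
  case (5 r)
  then show ?case
    by (simp add: minus_one_power_diff mult_ac flip: binomial_symmetric)
qed auto

section \<open>Equality with the Hahn sum\<close>

text \<open>Both sides count the pairs of disjoint subsets of sizes \<open>s\<close> and \<open>k\<close> of a set of size \<open>n\<close>.\<close>
lemma choose_mult_complement:
  assumes "k \<le> n" "s \<le> n"
  shows "(n choose s) * (n - s choose k) = (n choose k) * (n - k choose s)"
proof (cases "k + s \<le> n")
  case True
  have "(n choose s) * (n - s choose k) = (n choose (n - k)) * (n - k choose s)"
    using choose_mult[of s "n - k" n] True binomial_symmetric[of k "n - s"]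
    by (simp add: add.commute)
  then show ?thesis using assms by (simp flip: binomial_symmetric)
qed (use assms in \<open>simp add: binomial_eq_0\<close>)

text \<open>
  With \<open>j\<close> and \<open>k\<close> fixed, choosing \<open>j\<close> and \<open>k\<close> elements first leaves \<open>m - j - k\<close> elements to be
  distributed freely, and the sum becomes the alternating sum of a row of Pascal's triangle. It is
  nonzero only if that row is the top one.
\<close>
lemma alternating_trinomial_sum:
  fixes m j k :: nat
  assumes "j \<le> m"
  shows "(\<Sum>r\<le>m. (-1) ^ r * of_nat ((m choose r) * (r choose j) * (m - r choose k)))
       = (if k = m - j then (-1) ^ j * of_nat (m choose j) else (0::'a::comm_ring_1))"
    (is "?S = _")
proof -
  define n where "n = m - j"
  have m: "m = n + j" using assms by (simp add: n_def)
  have "?S = (\<Sum>r\<in>{j..m}. (-1) ^ r * of_nat ((m choose r) * (r choose j) * (m - r choose k)))"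
    by (rule sum.mono_neutral_right) (auto simp: binomial_eq_0)
  also have "\<dots> = (\<Sum>s\<le>n. (-1) ^ (s + j)
      * of_nat ((m choose (s + j)) * (s + j choose j) * (m - (s + j) choose k)))"
    by (rule sum.reindex_bij_witness[of _ "\<lambda>s. s + j" "\<lambda>r. r - j"]) (auto simp: m)
  also have "\<dots> = (\<Sum>s\<le>n. (-1) ^ j * of_nat (m choose j)
      * ((-1) ^ s * of_nat ((n choose s) * (n - s choose k))))"
  proof (rule sum.cong)
    fix s assume "s \<in> {..n}"
    then have "(m choose (s + j)) * (s + j choose j) = (m choose j) * (n choose s)"
      using choose_mult[of j "s + j" m] by (simp add: m)
    then have "(m choose (s + j)) * (s + j choose j) * (m - (s + j) choose k)
      = (m choose j) * ((n choose s) * (n - s choose k))"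
      by (simp add: m)
    then show "(-1) ^ (s + j)
        * of_nat ((m choose (s + j)) * (s + j choose j) * (m - (s + j) choose k))
      = (-1) ^ j * of_nat (m choose j)
        * ((-1) ^ s * (of_nat ((n choose s) * (n - s choose k)) :: 'a))"
      by (simp only: of_nat_mult power_add mult_ac)
  qed simp
  also have "\<dots> = (-1) ^ j * of_nat (m choose j)
      * (\<Sum>s\<le>n. (-1) ^ s * of_nat ((n choose s) * (n - s choose k)))"
    by (simp only: sum_distrib_left)
  also have "(\<Sum>s\<le>n. (-1) ^ s * of_nat ((n choose s) * (n - s choose k)))
      = (if k = n then 1 else (0::'a))"
  proof (cases "k \<le> n")
    case True
    have "(\<Sum>s\<le>n. (-1) ^ s * of_nat ((n choose s) * (n - s choose k)))
        = (\<Sum>s\<le>n. of_nat (n choose k) * ((-1) ^ s * (of_nat (n - k choose s) :: 'a)))"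
      using True by (intro sum.cong refl) (subst choose_mult_complement, auto simp: mult_ac)
    also have "\<dots> = of_nat (n choose k) * (\<Sum>s\<le>n. (-1) ^ s * of_nat (n - k choose s))"
      by (simp only: sum_distrib_left)
    also have "(\<Sum>s\<le>n. (-1) ^ s * (of_nat (n - k choose s) :: 'a))
        = (\<Sum>s\<le>n - k. (-1) ^ s * of_nat (n - k choose s))"
      by (rule sum.mono_neutral_right) (auto simp: binomial_eq_0)
    also have "\<dots> = (if k = n then 1 else 0)"
      using choose_alternating_sum[of "n - k", where ?'a = 'a] True by auto
    finally show ?thesis by simp
  qed (auto intro!: sum.neutral simp: binomial_eq_0)
  finally show ?thesis by (simp add: n_def)
qed

text \<open>
  The left side is, up to sign, the Hahn sum with its parameters expressed in \<open>X, Y, Z, U\<close>. In each pair of factors the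
  Vandermonde convolution splits off \<open>U\<close> or \<open>Z\<close>, and what is left of the second factor continues the
  rising factorial of \<open>X\<close> or \<open>Y\<close>. The resulting products no longer depend on \<open>r\<close>, so the sum over \<open>r\<close>
  can be carried out on the coefficients alone.
\<close>
lemma transvectant_alt:
  fixes X Y Z U :: "'a::comm_ring_1"
  shows "(\<Sum>r\<le>m. (-1) ^ r * of_nat (m choose r)
        * (pochhammer X r * pochhammer (X + U + of_nat r) (m - r))
        * (pochhammer Y (m - r) * pochhammer (Y + Z + of_nat (m - r)) r))
     = transvectant m X Y Z U"
proof -
  have expand: "pochhammer A (n - i) * pochhammer (A + B + of_nat (n - i)) i
      = (\<Sum>j\<le>n. of_nat (i choose j) * (pochhammer B j * pochhammer A (n - j)))"
    if "i \<le> n" for A B :: 'a and i n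
  proof -
    have "pochhammer A (n - i) * pochhammer (A + B + of_nat (n - i)) i
      = (\<Sum>j\<le>i. of_nat (i choose j) * pochhammer B j
          * (pochhammer A (n - i) * pochhammer (A + of_nat (n - i)) (i - j)))"
      using pochhammer_binomial_sum[of B "A + of_nat (n - i)" i]
      by (simp add: sum_distrib_left add_ac mult_ac)
    also have "\<dots> = (\<Sum>j\<le>i. of_nat (i choose j) * (pochhammer B j * pochhammer A (n - j)))"
    proof (rule sum.cong)
      fix j assume "j \<in> {..i}"
      then have "n - j - (n - i) = i - j" "n - i \<le> n - j" using that by auto
      then show "of_nat (i choose j) * pochhammer B j
          * (pochhammer A (n - i) * pochhammer (A + of_nat (n - i)) (i - j))
        = of_nat (i choose j) * (pochhammer B j * pochhammer A (n - j))"
        using pochhammer_product[of "n - i" "n - j" A] by (simp add: mult_ac)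
    qed simp
    also have "\<dots> = (\<Sum>j\<le>n. of_nat (i choose j) * (pochhammer B j * pochhammer A (n - j)))"
      by (rule sum.mono_neutral_left) (use that in \<open>auto simp: binomial_eq_0\<close>)
    finally show ?thesis .
  qed
  define G where "G j k = pochhammer Z j * pochhammer Y (m - j)
      * (pochhammer U k * pochhammer X (m - k))" for j k
  have "(\<Sum>r\<le>m. (-1) ^ r * of_nat (m choose r)
        * (pochhammer X r * pochhammer (X + U + of_nat r) (m - r))
        * (pochhammer Y (m - r) * pochhammer (Y + Z + of_nat (m - r)) r))
     = (\<Sum>r\<le>m. (-1) ^ r * of_nat (m choose r)
        * (\<Sum>j\<le>m. of_nat (r choose j) * (pochhammer Z j * pochhammer Y (m - j)))
        * (\<Sum>k\<le>m. of_nat (m - r choose k) * (pochhammer U k * pochhammer X (m - k))))"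
  proof (rule sum.cong)
    fix r assume "r \<in> {..m}"
    then show "(-1) ^ r * of_nat (m choose r)
        * (pochhammer X r * pochhammer (X + U + of_nat r) (m - r))
        * (pochhammer Y (m - r) * pochhammer (Y + Z + of_nat (m - r)) r)
      = (-1) ^ r * of_nat (m choose r)
        * (\<Sum>j\<le>m. of_nat (r choose j) * (pochhammer Z j * pochhammer Y (m - j)))
        * (\<Sum>k\<le>m. of_nat (m - r choose k) * (pochhammer U k * pochhammer X (m - k)))"
      using expand[of r m Y Z] expand[of "m - r" m X U] by simp
  qed simp
  also have "\<dots> = (\<Sum>r\<le>m. \<Sum>j\<le>m. \<Sum>k\<le>m.
      (-1) ^ r * of_nat ((m choose r) * (r choose j) * (m - r choose k)) * G j k)"
    unfolding G_def
    by (simp add: sum_distrib_left sum_distrib_right mult_ac)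
  also have "\<dots> = (\<Sum>j\<le>m. \<Sum>r\<le>m. \<Sum>k\<le>m.
      (-1) ^ r * of_nat ((m choose r) * (r choose j) * (m - r choose k)) * G j k)"
    by (rule sum.swap)
  also have "\<dots> = (\<Sum>j\<le>m. \<Sum>k\<le>m.
      (\<Sum>r\<le>m. (-1) ^ r * of_nat ((m choose r) * (r choose j) * (m - r choose k))) * G j k)"
    by (subst sum.swap) (simp only: sum_distrib_right)
  also have "\<dots> = (\<Sum>j\<le>m. \<Sum>k\<le>m. if k = m - j then (-1) ^ j * of_nat (m choose j) * G j k else 0)"
    by (intro sum.cong) (simp_all add: alternating_trinomial_sum del: of_nat_mult)
  also have "\<dots> = transvectant m X Y Z U"
    unfolding transvectant_def G_def by (intro sum.cong) (simp_all add: mult_ac)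
  finally show ?thesis .
qed

text \<open>
  The rising factorials of \<open>-x\<close> and \<open>x - c\<close> vanish outside the range of summation of \<^const>\<open>hahn\<close>, so the
  sum may run over all \<open>r \<le> m\<close>. Reading the factors \<open>(b - m + 1)\<^sub>r\<close> and \<open>(a - m + 1)\<^sub>m\<^sub>-\<^sub>r\<close> backwards
  brings them into the form treated in \<open>transvectant_alt\<close>; this costs the sign \<open>(-1)\<^sup>m\<close>.
\<close>
lemma hahn_eq_transvectant:
  assumes "0 \<le> m" "0 \<le> x" "x \<le> c"
  shows "hahn m a b c x
    = (-1) ^ nat m * transvectant (nat m) (- x) (x - c) (c - b - x) (x - a)"
proof -
  define n where "n = nat m"
  define F where "F r = (-1) ^ r * int (n choose r)
        * pochhammer (b - m + 1) r * pochhammer (- x) r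
        * pochhammer (a - m + 1) (n - r) * pochhammer (x - c) (n - r)" for r
  have m: "m = int n" using assms by (simp add: n_def)
  have "hahn m a b c x = (\<Sum>r\<in>{max 0 (x - c + m)..min m x}. F (nat r))"
    unfolding hahn_def F_def
    by (intro sum.cong) (auto simp: m nat_diff_distrib)
  also have "\<dots> = (\<Sum>r\<in>nat ` {max 0 (x - c + m)..min m x}. F r)"
    by (subst sum.reindex) (auto simp: inj_on_def)
  also have "\<dots> = (\<Sum>r\<le>n. F r)"
  proof (rule sum.mono_neutral_left)
    show "\<forall>r\<in>{..n} - nat ` {max 0 (x - c + m)..min m x}. F r = 0"
    proof
      fix r assume r: "r \<in> {..n} - nat ` {max 0 (x - c + m)..min m x}"
      have "int r \<notin> {max 0 (x - c + m)..min m x}"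
        using r by (metis DiffD2 image_eqI nat_int)
      then consider "nat x < r" | "nat (c - x) < n - r"
        using r m assms by fastforce
      then show "F r = 0"
      proof cases
        case 1
        then have "pochhammer (- int (nat x)) r = 0"
          by (simp only: pochhammer_of_nat_eq_0_lemma)
        then show ?thesis using assms by (simp add: F_def)
      next
        case 2
        then have "pochhammer (- int (nat (c - x))) (n - r) = 0"
          by (simp only: pochhammer_of_nat_eq_0_lemma)
        then show ?thesis using assms by (simp add: F_def)
      qed
    qed
  qed (auto simp: m)
  also have "\<dots> = (\<Sum>r\<le>n. (-1) ^ n * ((-1) ^ r * of_nat (n choose r)
        * (pochhammer (- x) r * pochhammer (- x + (x - a) + of_nat r) (n - r))
        * (pochhammer (x - c) (n - r)
           * pochhammer (x - c + (c - b - x) + of_nat (n - r)) r)))"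
  proof (rule sum.cong)
    fix r assume "r \<in> {..n}"
    then have r: "r \<le> n" by simp
    have 1: "pochhammer (b - m + 1) r = (-1) ^ r * pochhammer (m - b - r) r"
      using pochhammer_minus'[of "b - m + r" r] by simp
    have 2: "pochhammer (a - m + 1) (n - r) = (-1) ^ (n - r) * pochhammer (r - a) (n - r)"
      using pochhammer_minus'[of "a - r" "n - r"] r by (simp add: m of_nat_diff)
    show "F r = (-1) ^ n * ((-1) ^ r * of_nat (n choose r)
        * (pochhammer (- x) r * pochhammer (- x + (x - a) + of_nat r) (n - r))
        * (pochhammer (x - c) (n - r)
           * pochhammer (x - c + (c - b - x) + of_nat (n - r)) r))"
      unfolding F_def 1 2 minus_one_power_diff[OF r]
      using r by (simp add: m of_nat_diff algebra_simps flip: power_mult_distrib)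
  qed simp
  also have "\<dots> = (-1) ^ n * transvectant n (- x) (x - c) (c - b - x) (x - a)"
    by (simp only: transvectant_alt flip: sum_distrib_left)
  finally show ?thesis by (simp add: n_def)
qed

section \<open>The complementary symmetry\<close>

text \<open>
  The indices for which all six factorials of the next definition have nonnegative arguments.
\<close>
definition transvectant_support :: "nat \<Rightarrow> nat \<Rightarrow> nat \<Rightarrow> nat \<Rightarrow> nat \<Rightarrow> nat set" where
  "transvectant_support m x y z u = {r. r \<le> m \<and> r \<le> x \<and> r \<le> z \<and> m \<le> y + r \<and> m \<le> u + r}"

definition transvectant_fact_sum :: "nat \<Rightarrow> nat \<Rightarrow> nat \<Rightarrow> nat \<Rightarrow> nat \<Rightarrow> 'a::field_char_0" where
  "transvectant_fact_sum m x y z u =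
     (\<Sum>r\<in>transvectant_support m x y z u.
        (-1) ^ r / (fact r * fact (m - r) * fact (x - r) * fact (z - r)
                    * fact (y + r - m) * fact (u + r - m)))"

lemma pochhammer_uminus_of_nat:
  assumes "r \<le> n"
  shows "pochhammer (- of_nat n) r = ((-1) ^ r * fact n / fact (n - r) :: 'a::field_char_0)"
proof -
  have "fact n = (fact (n - r) * pochhammer (of_nat (n - r) + 1) r :: 'a)"
    using pochhammer_product[of "n - r" n "1::'a"] assms by (simp add: pochhammer_fact add_ac)
  moreover have "pochhammer (- of_nat n) r = (-1) ^ r * pochhammer (of_nat (n - r) + 1 :: 'a) r"
    using assms by (simp add: pochhammer_minus of_nat_diff)
  ultimately show ?thesis by simp
qed

text \<open>
  This isolates the prefactor \<open>m! x! y! z! u!\<close>, which explains the quotient of factorials in the second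
  symmetry: there \<open>x\<close> and \<open>u\<close> are preserved, and \<open>m, y, z\<close> are not.
\<close>
lemma transvectant_eq_fact_sum:
  "transvectant m (- of_nat x) (- of_nat y) (- of_nat z) (- of_nat u)
   = (fact m * fact x * fact y * fact z * fact u * transvectant_fact_sum m x y z u
      :: 'a::field_char_0)"
proof -
  let ?T = "\<lambda>r. (-1) ^ r * of_nat (m choose r)
        * (pochhammer (- of_nat x) r * pochhammer (- of_nat z) r)
        * (pochhammer (- of_nat y) (m - r) * pochhammer (- of_nat u) (m - r)) :: 'a"
  have "transvectant m (- of_nat x) (- of_nat y) (- of_nat z) (- of_nat u :: 'a)
      = (\<Sum>r\<in>transvectant_support m x y z u. ?T r)"
    unfolding transvectant_def
  proof (rule sum.mono_neutral_right)
    show "\<forall>r\<in>{..m} - transvectant_support m x y z u. ?T r = 0"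
      by (auto simp: transvectant_support_def pochhammer_of_nat_eq_0_iff)
  qed (auto simp: transvectant_support_def)
  also have "\<dots> = (\<Sum>r\<in>transvectant_support m x y z u.
      fact m * fact x * fact y * fact z * fact u
      * ((-1) ^ r / (fact r * fact (m - r) * fact (x - r) * fact (z - r)
                    * fact (y + r - m) * fact (u + r - m))))"
  proof (rule sum.cong)
    fix r assume "r \<in> transvectant_support m x y z u"
    then have r: "r \<le> m" "r \<le> x" "r \<le> z" "m - r \<le> y" "m - r \<le> u"
      by (auto simp: transvectant_support_def)
    have sub: "y - (m - r) = y + r - m" "u - (m - r) = u + r - m"
      using r by auto
    show "?T r = fact m * fact x * fact y * fact z * fact u
      * ((-1) ^ r / (fact r * fact (m - r) * fact (x - r) * fact (z - r)
                    * fact (y + r - m) * fact (u + r - m)))"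
      using r by (simp add: binomial_fact pochhammer_uminus_of_nat sub mult_ac)
  qed simp
  finally show ?thesis
    by (simp only: transvectant_fact_sum_def sum_distrib_left)
qed

text \<open>
  The substitution \<open>r \<mapsto> x - r\<close> exchanges \<open>r\<close> with \<open>x - r\<close>, sends \<open>m - r\<close>, \<open>z - r\<close>, \<open>y + r - m\<close>, \<open>u + r - m\<close>
  to the other four entries for the new parameters, and maps the support onto the new support.
\<close>
lemma transvectant_fact_sum_complement:
  assumes "m \<le> x + u" "m \<le> z + u" "m \<le> x + y"
  shows "transvectant_fact_sum (x + u - m) x (u + z - m) (x + y - m) u
       = ((-1) ^ x * transvectant_fact_sum m x y z u :: 'a::field_char_0)"
  unfolding transvectant_fact_sum_def sum_distrib_left
proof (rule sum.reindex_bij_witness[of _ "\<lambda>r. x - r" "\<lambda>r. x - r"], goal_cases)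
  case (5 r)
  then have r: "r \<le> x" "x + u - m \<le> u + z - m + r" "x \<le> m + r"
      "r \<le> x + u - m" "r \<le> x + y - m"
    using assms by (auto simp: transvectant_support_def)
  have "x - (x - r) = r" "m - (x - r) = u + r - (x + u - m)"
      "z - (x - r) = u + z - m + r - (x + u - m)" "y + (x - r) - m = x + y - m - r"
      "u + (x - r) - m = x + u - m - r"
    using r assms by auto
  moreover have "(-1) ^ x * (-1) ^ (x - r) = ((-1) ^ r :: 'a)"
    using r by (simp add: minus_one_power_diff flip: power_mult_distrib mult.assoc)
  ultimately show ?case
    by (simp add: mult_ac)
qed (use assms in \<open>auto simp: transvectant_support_def\<close>)

lemma transvectant_complement:
  assumes "m \<le> x + u" "m \<le> z + u" "m \<le> x + y"
  shows "transvectant m (- of_nat x) (- of_nat y) (- of_nat z) (- of_nat u)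
     = ((-1) ^ x * (fact m * fact y * fact z
          / (fact (u + z - m) * fact (x + y - m) * fact (x + u - m)))
        * transvectant (x + u - m) (- of_nat x) (- of_nat (u + z - m))
            (- of_nat (x + y - m)) (- of_nat u) :: 'a::field_char_0)"
  unfolding transvectant_eq_fact_sum transvectant_fact_sum_complement[OF assms]
  by (simp add: field_simps flip: power_mult_distrib)

lemma of_int_transvectant:
  "of_int (transvectant m X Y Z U)
   = transvectant m (of_int X) (of_int Y) (of_int Z) (of_int U)"
  by (simp add: transvectant_def pochhammer_of_int)

section \<open>Symmetries of the Hahn polynomials\<close>

theorem lemma3p19:
  fixes a b c m x :: int
  assumes "0 \<le> c" and "c \<le> a + b"
    and "0 \<le> m" and "m \<le> Min {a, b, c, a + b - c}"
    and "max (c - b) 0 \<le> x" and "x \<le> min a c"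
  shows "hahn m a b c x = (-1) ^ nat m * hahn m b a c (c - x)
    \<and> rat_of_int (hahn m a b c x) =
        (-1) ^ nat (a - x)
        * (fact (nat m) * fact (nat (c - x)) * fact (nat (b - c + x))
           / (fact (nat (a + b - c - m)) * fact (nat (c - m)) * fact (nat (a - m))))
        * rat_of_int (hahn (a - m) a (a + b - 2 * m) (a + b - m - c + x) x)
    \<and> hahn m a b c x = hahn m (a + b - c) c b (b - c + x)"
proof (intro conjI)
  have bounds: "0 \<le> m" "m \<le> a" "m \<le> b" "m \<le> c" "m \<le> a + b - c"
      "c - b \<le> x" "0 \<le> x" "x \<le> a" "x \<le> c"
    using assms by auto
  show "hahn m a b c x = (-1) ^ nat m * hahn m b a c (c - x)"
    using bounds transvectant_reflect[of "nat m" "x - c" "- x" "x - a" "c - b - x"]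
    by (simp add: hahn_eq_transvectant[of m x] hahn_eq_transvectant[of m "c - x"] algebra_simps)
  show "hahn m a b c x = hahn m (a + b - c) c b (b - c + x)"
    using bounds transvectant_swap_XZ[of "nat m" "- x" "x - c" "c - b - x" "x - a"]
      hahn_eq_transvectant[of m x c a b]
      hahn_eq_transvectant[of m "b - c + x" b "a + b - c" c]
    by (simp add: algebra_simps)
  \<comment> \<open>Natural number versions of \<open>m, x, y, z, u\<close> for the second symmetry.\<close>
  define n p q s t where "n = nat m" "p = nat x" "q = nat (c - x)" "s = nat (b - c + x)"
    "t = nat (a - x)"
  have int_eq: "m = int n" "x = int p" "c = int p + int q" "b = int q + int s" "a = int p + int t"
    using bounds by (auto simp: n_p_q_s_t_def)
  have le: "n \<le> p + t" "n \<le> s + t" "n \<le> p + q" "n \<le> q + s"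
    using bounds unfolding int_eq by linarith+
  have H: "rat_of_int (hahn m a b c x)
      = (-1) ^ n * transvectant n (- of_nat p) (- of_nat q) (- of_nat s) (- of_nat t)"
    using bounds by (simp add: hahn_eq_transvectant of_int_transvectant int_eq)
  have H': "rat_of_int (hahn (a - m) a (a + b - 2 * m) (a + b - m - c + x) x)
      = (-1) ^ (p + t - n) * transvectant (p + t - n) (- of_nat p) (- of_nat (t + s - n))
            (- of_nat (p + q - n)) (- of_nat t)"
  proof -
    have "nat (a - m) = p + t - n" using le by (simp add: int_eq)
    then show ?thesis
      using bounds le
      by (simp add: hahn_eq_transvectant of_int_transvectant int_eq of_nat_diff algebra_simps)
  qed
  have sign: "(-1) ^ n * (-1) ^ p = (-1) ^ t * (-1) ^ (p + t - n :: nat) * (1 :: rat)"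
  proof -
    have "(-1) ^ t * (-1) ^ (p + t - n) = ((-1) ^ t * (-1) ^ t) * ((-1) ^ n * (-1) ^ p :: rat)"
      using le by (simp add: minus_one_power_diff power_add)
    then show ?thesis by (simp flip: power_mult_distrib)
  qed
  have nats: "nat (a + b - c - m) = t + s - n" "nat (c - m) = p + q - n" "nat (a - m) = p + t - n"
    using le by (auto simp: int_eq)
  show "rat_of_int (hahn m a b c x) =
        (-1) ^ nat (a - x)
        * (fact (nat m) * fact (nat (c - x)) * fact (nat (b - c + x))
           / (fact (nat (a + b - c - m)) * fact (nat (c - m)) * fact (nat (a - m))))
        * rat_of_int (hahn (a - m) a (a + b - 2 * m) (a + b - m - c + x) x)"
    unfolding H H' nats transvectant_complement[OF le(1-3)]
    using sign by (simp flip: n_p_q_s_t_def)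
qed

end
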